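(* Let $R_n$ be a Markov chain on a set $G$ that is strongly connected, finitely supported, and invariant under some transitive group of automorphisms of $G$. That is, if $p(x,y)$ denotes the one-step transition probabilities, there is a group $\Gamma$ of bijections of $G$, acting transitively on $G$, with $p(\varphi(x),\varphi(y))=p(x,y)$ for all $\varphi\in\Gamma$ and $x,y\in G$. Assume that the directed balls of $G$ grow exponentially. Then there exists a non-constant positive harmonic function $f:G\to\mathbb{R}$ for the chain $R_n$.
   Context: The Markov chain is time-homogeneous with one-step transition probabilities $p(x,y)$, $x,y\in G$. Strongly connected: for any two states $x,y\in G$ there is a positive probability for the chain started at $x$ to reach $y$ in a finite number of steps. Finitely supported: for every state $x$ there are only finitely many $y$ with $p(x,y)>0$. Directed ball: for $g\in G$ and $r\ge 0$, $B(g,r)$ is the set of all $h\in G$ such that for some integer $0\le s\le r$ the probability that the chain started at $g$ is at $h$ after $s$ steps is positive. Exponential growth of directed balls: there is a constant $c>1$ such that $|B(g,r)|\ge c^r$ for all sufficiently large $r$ (by the transitive invariance, $|B(g,r)|$ does not depend on $g$). Harmonic: $f:G\to\mathbb{R}$ is harmonic for $R_n$ if $f(R_n)$ is a martingale, i.e. $f(x)=\sum_{y\in G}p(x,y)f(y)$ for every $x\in G$. Positive means $f(x)>0$ for all $x\in G$. *)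

theory Defs
  imports "HOL-Probability.Probability" "HOL-Algebra.Bij"
begin

text \<open>
  The state space \<open>G\<close> is the universe of the type \<open>'a\<close>. A time-homogeneous Markov chain is given by
  its transition kernel \<open>K :: 'a \<Rightarrow> 'a pmf\<close>, with one-step transition probabilities
  \<open>p(x,y) = pmf (K x) y\<close>.
\<close>

text \<open>Distribution of the chain after \<open>n\<close> steps, as a function of the starting state.\<close>

primrec n_step :: "('a \<Rightarrow> 'a pmf) \<Rightarrow> nat \<Rightarrow> 'a \<Rightarrow> 'a pmf" where
  "n_step K 0 x = return_pmf x"
| "n_step K (Suc n) x = bind_pmf (n_step K n x) K"

definition strongly_connected :: "('a \<Rightarrow> 'a pmf) \<Rightarrow> bool" where
  "strongly_connected K \<longleftrightarrow> (\<forall>x y. \<exists>n. pmf (n_step K n x) y > 0)"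

definition finitely_supported :: "('a \<Rightarrow> 'a pmf) \<Rightarrow> bool" where
  "finitely_supported K \<longleftrightarrow> (\<forall>x. finite {y. pmf (K x) y > 0})"

definition acts_transitively :: "('a \<Rightarrow> 'a) set \<Rightarrow> bool" where
  "acts_transitively \<Gamma> \<longleftrightarrow> (\<forall>x y. \<exists>\<phi>\<in>\<Gamma>. \<phi> x = y)"

definition invariant_under :: "('a \<Rightarrow> 'a pmf) \<Rightarrow> ('a \<Rightarrow> 'a) set \<Rightarrow> bool" where
  "invariant_under K \<Gamma> \<longleftrightarrow> (\<forall>\<phi>\<in>\<Gamma>. \<forall>x y. pmf (K (\<phi> x)) (\<phi> y) = pmf (K x) y)"

definition directed_ball :: "('a \<Rightarrow> 'a pmf) \<Rightarrow> 'a \<Rightarrow> real \<Rightarrow> 'a set" where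
  "directed_ball K g r = {h. \<exists>s::nat. real s \<le> r \<and> pmf (n_step K s g) h > 0}"

text \<open>
  For finitely supported chains directed balls are finite, so \<open>card\<close> is their true cardinality. Under
  a transitive invariance this cardinality does not depend on the centre \<open>g\<close>, so the quantifier over
  \<open>g\<close> could equivalently be existential.
\<close>

definition exponential_ball_growth :: "('a \<Rightarrow> 'a pmf) \<Rightarrow> bool" where
  "exponential_ball_growth K \<longleftrightarrow>
     (\<exists>c>1. \<forall>g. \<forall>\<^sub>F r in at_top. real (card (directed_ball K g r)) \<ge> c powr r)"

definition harmonic :: "('a \<Rightarrow> 'a pmf) \<Rightarrow> ('a \<Rightarrow> real) \<Rightarrow> bool" where
  "harmonic K f \<longleftrightarrow> (\<forall>x. ((\<lambda>y. pmf (K x) y * f y) has_sum f x) UNIV)"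

end

theory Submission
  imports Defs "HOL-Real_Asymp.Real_Asymp"
begin

text \<open>
  Suppose that all positive harmonic functions are constant. By compactness, a positive function
  that is nearly harmonic (\<open>f = \<lambda> P f\<close> with \<open>\<lambda>\<close> close to 1) on a large directed ball around \<open>x\<close> hardly
  grows along an edge leaving \<open>x\<close>; by transitivity this is uniform in \<open>x\<close>. Fix such a \<open>\<lambda> < 1\<close>. The
  discounted Green function \<open>G(x,y) = (\<Sum>n. \<lambda>^n p\<^sub>n(x,y))\<close> satisfies \<open>f = \<lambda> P f\<close> away from \<open>y\<close> as a
  function of \<open>x\<close>, so following a path from \<open>x\<close> to \<open>y\<close> gives \<open>G(x,y) \<ge> c \<rho>^n\<close> for \<open>y\<close> in the directed
  ball of radius \<open>n\<close>, with \<open>\<rho>\<close> as close to 1 as desired. But \<open>G(x,\<cdot>)\<close> has total mass \<open>1 / (1 - \<lambda>)\<close>,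
  which is incompatible with exponential growth of the balls.
\<close>

section \<open>The transition operator\<close>

text \<open>The operator \<open>P\<close> of the overview. For a finitely supported kernel, summing
  over the support makes \<open>transition_op K f x\<close> a finite combination of values of
  \<open>f\<close>, hence continuous in \<open>f\<close> for the product topology.\<close>

definition transition_op :: "('a \<Rightarrow> 'a pmf) \<Rightarrow> ('a \<Rightarrow> real) \<Rightarrow> 'a \<Rightarrow> real" where
  "transition_op K f x = (\<Sum>y\<in>set_pmf (K x). pmf (K x) y * f y)"

definition nat_ball :: "('a \<Rightarrow> 'a pmf) \<Rightarrow> 'a \<Rightarrow> nat \<Rightarrow> 'a set" where
  "nat_ball K x n = (\<Union>s\<le>n. set_pmf (n_step K s x))"

lemma directed_ball_of_nat: "directed_ball K x (real n) = nat_ball K x n"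
  by (auto simp: directed_ball_def nat_ball_def pmf_positive_iff)

lemma nat_ball_mono: "m \<le> n \<Longrightarrow> nat_ball K x m \<subseteq> nat_ball K x n"
  by (auto simp: nat_ball_def intro: order_trans)

lemma set_n_step_subset_nat_ball: "s \<le> n \<Longrightarrow> set_pmf (n_step K s x) \<subseteq> nat_ball K x n"
  by (auto simp: nat_ball_def)

lemma finite_set_n_step:
  assumes "\<And>x. finite (set_pmf (K x))"
  shows "finite (set_pmf (n_step K n x))"
  using assms by (induction n) auto

lemma finite_nat_ball:
  assumes "\<And>x. finite (set_pmf (K x))"
  shows "finite (nat_ball K x n)"
  using assms by (simp add: nat_ball_def finite_set_n_step)

lemma n_step_add: "n_step K (m + n) x = bind_pmf (n_step K m x) (n_step K n)"
proof (induction n)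
  case 0
  have "n_step K 0 = return_pmf" by (rule ext) simp
  then show ?case by (simp add: bind_return_pmf')
next
  case (Suc n)
  then show ?case by (simp add: bind_assoc_pmf)
qed

lemma n_step_Suc_first: "n_step K (Suc n) x = bind_pmf (K x) (n_step K n)"
  using n_step_add[of K 1 n x] by (simp add: bind_return_pmf)

lemma nat_ball_subset:
  assumes "y \<in> set_pmf (n_step K m x)"
  shows "nat_ball K y n \<subseteq> nat_ball K x (m + n)"
proof
  fix z assume "z \<in> nat_ball K y n"
  then obtain s where "s \<le> n" "z \<in> set_pmf (n_step K s y)" by (auto simp: nat_ball_def)
  then show "z \<in> nat_ball K x (m + n)"
    using assms set_n_step_subset_nat_ball[of "m + s" "m + n" K x] by (auto simp: n_step_add)
qed

lemma pmf_n_step_Suc_first: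
  assumes "finite (set_pmf (K x))"
  shows "pmf (n_step K (Suc n) x) y = (\<Sum>z\<in>set_pmf (K x). pmf (K x) z * pmf (n_step K n z) y)"
  unfolding n_step_Suc_first pmf_bind
  using assms by (subst integral_measure_pmf[where A = "set_pmf (K x)"]) auto

text \<open>The weights vanish off the support, so the unconditional sum collapses to a finite
  one.\<close>

lemma harmonic_iff_transition_op:
  assumes "\<And>x. finite (set_pmf (K x))"
  shows "harmonic K f \<longleftrightarrow> (\<forall>x. transition_op K f x = f x)"
proof -
  have "((\<lambda>y. pmf (K x) y * f y) has_sum c) UNIV \<longleftrightarrow> transition_op K f x = c" for x c
  proof -
    have "((\<lambda>y. pmf (K x) y * f y) has_sum c) UNIV \<longleftrightarrow>
          ((\<lambda>y. pmf (K x) y * f y) has_sum c) (set_pmf (K x))"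
      by (rule has_sum_cong_neutral) (auto simp: set_pmf_iff)
    also have "\<dots> \<longleftrightarrow> transition_op K f x = c"
      using assms by (auto simp: transition_op_def has_sum_finite_iff)
    finally show ?thesis .
  qed
  then show ?thesis by (simp add: harmonic_def)
qed

lemma transition_op_ge_single:
  assumes "finite (set_pmf (K x))" "y \<in> set_pmf (K x)" "\<And>z. 0 \<le> f z"
  shows "pmf (K x) y * f y \<le> transition_op K f x"
  unfolding transition_op_def
  using assms by (intro member_le_sum) auto

lemma continuous_on_transition_op: "continuous_on UNIV (\<lambda>f. transition_op K f x)"
  unfolding transition_op_def
  by (intro continuous_intros continuous_on_product_coordinates)

lemma transition_op_divide: "transition_op K (\<lambda>z. f z / c) x = transition_op K f x / c"
  by (simp add: transition_op_def sum_divide_distrib)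

section \<open>Invariance\<close>

text \<open>Surjectivity of \<open>\<phi>\<close> lets every target state be written as
  \<open>\<phi> y\<close>. The push-forward form of invariance passes through
  \<open>bind_pmf\<close>, and so extends to all step counts.\<close>

lemma invariant_kernel_map:
  assumes "bij \<phi>" "\<And>x y. pmf (K (\<phi> x)) (\<phi> y) = pmf (K x) y"
  shows "K (\<phi> x) = map_pmf \<phi> (K x)"
proof (rule pmf_eqI)
  fix z
  obtain y where "z = \<phi> y" using assms(1) by (meson bij_pointE)
  then show "pmf (K (\<phi> x)) z = pmf (map_pmf \<phi> (K x)) z"
    using assms by (simp add: pmf_map_inj' bij_is_inj)
qed

lemma n_step_map:
  assumes "\<And>x. K (\<phi> x) = map_pmf \<phi> (K x)"
  shows "n_step K n (\<phi> x) = map_pmf \<phi> (n_step K n x)"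
  by (induction n) (auto simp: map_bind_pmf bind_map_pmf assms)

lemma nat_ball_map:
  assumes "\<And>x. K (\<phi> x) = map_pmf \<phi> (K x)"
  shows "nat_ball K (\<phi> x) n = \<phi> ` nat_ball K x n"
  by (auto simp: nat_ball_def n_step_map[of K \<phi>, OF assms])

lemma transition_op_map:
  assumes "\<And>x. K (\<phi> x) = map_pmf \<phi> (K x)" "inj \<phi>"
  shows "transition_op K f (\<phi> x) = transition_op K (f \<circ> \<phi>) x"
  using assms(2)
  by (simp add: transition_op_def assms(1) sum.reindex inj_on_subset pmf_map_inj')

section \<open>The discounted Green function\<close>

definition green :: "('a \<Rightarrow> 'a pmf) \<Rightarrow> real \<Rightarrow> 'a \<Rightarrow> 'a \<Rightarrow> real" where
  "green K l x y = (\<Sum>n. l ^ n * pmf (n_step K n x) y)"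

lemma summable_green:
  fixes l :: real
  assumes "0 \<le> l" "l < 1"
  shows "summable (\<lambda>n. l ^ n * pmf (n_step K n x) y)"
proof (rule summable_comparison_test)
  show "\<exists>N. \<forall>n\<ge>N. norm (l ^ n * pmf (n_step K n x) y) \<le> l ^ n"
    using assms by (auto simp: mult_left_le pmf_le_1)
  show "summable (\<lambda>n. l ^ n)" using assms by (simp add: summable_geometric)
qed

lemma green_pos:
  assumes "0 < l" "l < 1" "y \<in> set_pmf (n_step K n x)"
  shows "0 < green K l x y"
  unfolding green_def
  using assms by (intro suminf_pos2[where i = n] summable_green) (auto simp: pmf_positive)

text \<open>First-step analysis: the term \<open>n = 0\<close> is the indicator, and conditioning
  each later term on the first step pulls out one factor \<open>l\<close>. Hence the discounted
  equation holds at every \<open>x\<close> other than \<open>y\<close>.\<close>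

lemma green_step:
  assumes "0 \<le> l" "l < 1" "finite (set_pmf (K x))"
  shows "green K l x y = of_bool (x = y) + l * transition_op K (\<lambda>z. green K l z y) x"
proof -
  let ?g = "\<lambda>n z. l ^ n * pmf (n_step K n z) y"
  have "(\<Sum>n. ?g (Suc n) x) = (\<Sum>n. \<Sum>z\<in>set_pmf (K x). l * pmf (K x) z * ?g n z)"
    by (simp only: pmf_n_step_Suc_first[of K x, OF assms(3)]) (simp add: sum_distrib_left algebra_simps)
  also have "\<dots> = (\<Sum>z\<in>set_pmf (K x). \<Sum>n. l * pmf (K x) z * ?g n z)"
    using assms by (intro suminf_sum summable_mult summable_green)
  also have "\<dots> = (\<Sum>z\<in>set_pmf (K x). l * pmf (K x) z * green K l z y)"
    unfolding green_def using assms by (intro sum.cong refl suminf_mult summable_green)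
  also have "\<dots> = l * transition_op K (\<lambda>z. green K l z y) x"
    by (simp add: transition_op_def sum_distrib_left mult.assoc)
  finally have "(\<Sum>n. ?g (Suc n) x) = l * transition_op K (\<lambda>z. green K l z y) x" .
  moreover have "(\<Sum>n. ?g (Suc n) x) = green K l x y - ?g 0 x"
    unfolding green_def using assms by (intro suminf_split_head summable_green)
  ultimately show ?thesis by (auto split: if_splits simp: of_bool_def)
qed

text \<open>Each \<open>n_step K n x\<close> gives \<open>A\<close> mass at most 1, so a geometric
  series remains.\<close>

lemma sum_green_le:
  assumes "0 \<le> l" "l < 1" "finite A"
  shows "(\<Sum>y\<in>A. green K l x y) \<le> 1 / (1 - l)"
proof -
  have "(\<Sum>y\<in>A. green K l x y) = (\<Sum>n. \<Sum>y\<in>A. l ^ n * pmf (n_step K n x) y)"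
    unfolding green_def using assms by (intro suminf_sum[symmetric] summable_green)
  also have "\<dots> \<le> (\<Sum>n. l ^ n)"
  proof (rule suminf_le)
    fix n
    have "(\<Sum>y\<in>A. pmf (n_step K n x) y) \<le> 1"
      using assms(3) by (simp flip: measure_measure_pmf_finite)
    then show "(\<Sum>y\<in>A. l ^ n * pmf (n_step K n x) y) \<le> l ^ n"
      using assms by (simp add: mult_left_le flip: sum_distrib_left)
  qed (use assms in \<open>auto intro!: summable_sum summable_green summable_geometric\<close>)
  also have "\<dots> = 1 / (1 - l)" using assms by (simp add: suminf_geometric)
  finally show ?thesis .
qed

lemma green_map:
  assumes "\<And>x. K (\<phi> x) = map_pmf \<phi> (K x)" "inj \<phi>"
  shows "green K l (\<phi> x) (\<phi> y) = green K l x y"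
  using assms(2) by (simp add: green_def n_step_map[of K \<phi>, OF assms(1)] pmf_map_inj')

section \<open>Compactness\<close>

text \<open>Harnack inequality along a path: an edge from \<open>w\<close> to \<open>y\<close> costs
  a factor \<open>pmf (K w) y / 2\<close>, the 2 coming from \<open>l \<ge> 1/2\<close>. The point
  is that \<open>C\<close> is independent of both \<open>f\<close> and \<open>l\<close>.\<close>

lemma harnack_n_step:
  assumes fin: "\<And>x. finite (set_pmf (K x))" and "y \<in> set_pmf (n_step K n x)"
  shows "\<exists>C>0. \<forall>f l. (\<forall>z. 0 < f z) \<longrightarrow> 1 / 2 \<le> l \<longrightarrow>
           (\<forall>z\<in>nat_ball K x n. f z = l * transition_op K f z) \<longrightarrow> C * f y \<le> f x"
  using assms(2)
proof (induction n arbitrary: y)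
  case 0
  then show ?case by (intro exI[of _ 1]) auto
next
  case (Suc n)
  obtain w where w: "w \<in> set_pmf (n_step K n x)" "y \<in> set_pmf (K w)"
    using Suc.prems by auto
  obtain C where C: "C > 0" and CH: "\<And>f l. (\<forall>z. 0 < f z) \<Longrightarrow> 1 / 2 \<le> l \<Longrightarrow>
      (\<forall>z\<in>nat_ball K x n. f z = l * transition_op K f z) \<Longrightarrow> C * f w \<le> f x"
    using Suc.IH[OF w(1)] by blast
  have "C * (pmf (K w) y / 2) * f y \<le> f x"
    if f: "\<forall>z. 0 < f z" and l: "1 / 2 \<le> l"
      and h: "\<forall>z\<in>nat_ball K x (Suc n). f z = l * transition_op K f z" for f l
  proof -
    have "w \<in> nat_ball K x (Suc n)"
      using w(1) set_n_step_subset_nat_ball[of n "Suc n" K x] by auto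
    then have fw: "f w = l * transition_op K f w" using h by blast
    have p: "pmf (K w) y * f y \<le> transition_op K f w"
      using f by (intro transition_op_ge_single fin w(2)) (auto intro: less_imp_le)
    have "pmf (K w) y / 2 * f y = 1 / 2 * (pmf (K w) y * f y)" by simp
    also have "\<dots> \<le> l * transition_op K f w"
      using f l p by (intro mult_mono) (auto intro!: mult_nonneg_nonneg less_imp_le[of 0 "f y"])
    finally have "C * (pmf (K w) y / 2 * f y) \<le> C * f w"
      using C fw by simp
    also have "\<dots> \<le> f x"
      using h nat_ball_mono[of n "Suc n" K x] by (intro CH[of f l] f l) auto
    finally show ?thesis by (simp only: mult.assoc)
  qed
  moreover have "0 < C * (pmf (K w) y / 2)" using C w(2) by (simp add: pmf_positive)
  ultimately show ?case by blast
qed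

lemma compact_box: "compact {f :: 'a \<Rightarrow> real. \<forall>x. f x \<in> {0..D x}}"
proof -
  have "compactin (product_topology (\<lambda>_. euclidean) UNIV) (PiE UNIV (\<lambda>x. {0..D x}))"
    by (subst compactin_PiE) auto
  moreover have "PiE UNIV (\<lambda>x. {0..D x}) = {f. \<forall>x. f x \<in> {0..D x}}"
    by (auto simp: PiE_def Pi_def)
  ultimately show ?thesis by (simp add: euclidean_product_topology)
qed

text \<open>A cluster point replaces the limit of a diagonal subsequence: every closed condition
  that holds eventually along the sequence passes to it.\<close>

lemma compact_sequence_cluster:
  fixes g :: "nat \<Rightarrow> 'b::topological_space"
  assumes "compact U" "\<And>k. g k \<in> U"
  obtains f where "\<And>S. closed S \<Longrightarrow> \<forall>\<^sub>F k in sequentially. g k \<in> S \<Longrightarrow> f \<in> S"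
proof -
  let ?F = "filtermap g sequentially"
  obtain f where f: "inf (nhds f) ?F \<noteq> bot"
    using assms unfolding compact_filter
    by (metis (no_types, lifting) always_eventually eventually_filtermap filtermap_bot_iff
        sequentially_bot)
  show ?thesis
  proof (rule that, rule ccontr)
    fix S assume S: "closed S" "\<forall>\<^sub>F k in sequentially. g k \<in> S" and "f \<notin> S"
    then have "\<forall>\<^sub>F h in nhds f. h \<in> - S" by (intro eventually_nhds_in_open) auto
    moreover have "\<forall>\<^sub>F h in ?F. h \<in> S" using S by (simp add: eventually_filtermap)
    ultimately have "\<forall>\<^sub>F h in inf (nhds f) ?F. False"
      unfolding eventually_inf by force
    then show False using f by (simp add: trivial_limit_def)
  qed
qed

text \<open>If this failed for arbitrarily large \<open>k\<close>, the counterexamples, scaled to be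
  1 at \<open>a\<close>, would accumulate at a positive harmonic \<open>f\<close> with
  \<open>1 \<le> \<rho> * f y\<close>, which is not constant. The single parameter \<open>k\<close>
  sends the discount to 1 while the balls exhaust the state space.\<close>

lemma liouville_edge:
  assumes fin: "\<And>x. finite (set_pmf (K x))"
    and sc: "\<And>x y. \<exists>n. y \<in> set_pmf (n_step K n x)"
    and liouville: "\<And>f. (\<And>x. transition_op K f x = f x) \<Longrightarrow> (\<And>x. 0 < f x) \<Longrightarrow> f constant_on UNIV"
    and rho: "\<rho> < 1"
  shows "\<forall>\<^sub>F k in sequentially. \<forall>f. (\<forall>x. 0 < f x) \<longrightarrow>
           (\<forall>z\<in>nat_ball K a k. f z = (1 - 1 / (real k + 2)) * transition_op K f z) \<longrightarrow> \<rho> * f y \<le> f a"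
    (is "eventually ?P _")
proof (rule ccontr)
  define lam where "lam k = 1 - 1 / (real k + 2)" for k :: nat
  have lam: "1 / 2 \<le> lam k" "lam k < 1" "lam k \<ge> 1 - 1 / (real j + 2)" if "j \<le> k" for j k
    using that by (auto simp: lam_def field_simps intro!: divide_left_mono)
  assume "\<not> eventually ?P sequentially"
  then have "\<exists>n\<ge>k. \<not> ?P n" for k
    by (auto simp: eventually_sequentially)
  then have "\<forall>k. \<exists>n f. n \<ge> k \<and> (\<forall>x. 0 < f x) \<and>
      (\<forall>z\<in>nat_ball K a n. f z = lam n * transition_op K f z) \<and> f a < \<rho> * f y"
    unfolding lam_def by (meson not_le)
  then obtain N F where N: "\<And>k. N k \<ge> k" and Fpos: "\<And>k x. 0 < F k x"
    and Fh: "\<And>k z. z \<in> nat_ball K a (N k) \<Longrightarrow> F k z = lam (N k) * transition_op K (F k) z"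
    and Fy: "\<And>k. F k a < \<rho> * F k y"
    by metis
  define h where "h k x = F k x / F k a" for k x
  have hpos: "0 < h k x" and ha: "h k a = 1" and hy: "1 \<le> \<rho> * h k y" for k x
    using Fpos[of k x] Fpos[of k a] Fy[of k] by (auto simp: h_def field_simps)
  have hh: "h k z = lam (N k) * transition_op K (h k) z" if "z \<in> nat_ball K a k" for k z
  proof -
    have "h k = (\<lambda>z. F k z / F k a)" by (auto simp: h_def)
    then show ?thesis
      using Fh[of z k] that nat_ball_mono[OF N[of k], of K a] by (auto simp: transition_op_divide)
  qed
  \<comment> \<open>The ball around \<open>w\<close> needed for a path from \<open>w\<close> to
    \<open>x\<close> lies in the \<open>k\<close>-ball around \<open>a\<close> once
    \<open>k \<ge> m + n\<close>, so one \<open>C\<close> serves all large \<open>k\<close>. Taking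
    \<open>w = a\<close> bounds \<open>h k\<close> above; taking \<open>x = a\<close> bounds it
    below.\<close>
  have harnack: "\<exists>C>0. \<forall>\<^sub>F k in sequentially. C * h k x \<le> h k w" for w x
  proof -
    obtain m where m: "w \<in> set_pmf (n_step K m a)" using sc by blast
    obtain n where n: "x \<in> set_pmf (n_step K n w)" using sc by blast
    have sub: "nat_ball K w n \<subseteq> nat_ball K a (m + n)"
      using m by (rule nat_ball_subset)
    obtain C where "C > 0" and C: "\<And>f l. (\<forall>z. 0 < f z) \<Longrightarrow> 1 / 2 \<le> l \<Longrightarrow>
        (\<forall>z\<in>nat_ball K w n. f z = l * transition_op K f z) \<Longrightarrow> C * f x \<le> f w"
      using harnack_n_step[OF fin n] by blast
    have "C * h k x \<le> h k w" if "k \<ge> m + n" for k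
      using hpos lam(1)[OF order_refl] sub nat_ball_mono[OF that, of K a]
      by (intro C[of _ "lam (N k)"]) (auto intro!: hh)
    then show ?thesis using \<open>C > 0\<close> by (auto simp: eventually_sequentially)
  qed
  have "\<forall>x. \<exists>D. \<forall>\<^sub>F k in sequentially. h k x \<le> D"
  proof
    fix x
    obtain C where "C > 0" "\<forall>\<^sub>F k in sequentially. C * h k x \<le> h k a" using harnack by blast
    then have "\<forall>\<^sub>F k in sequentially. h k x \<le> 1 / C" by (simp add: ha field_simps)
    then show "\<exists>D. \<forall>\<^sub>F k in sequentially. h k x \<le> D" by blast
  qed
  then obtain D where D: "\<And>x. \<forall>\<^sub>F k in sequentially. h k x \<le> D x" by metis
  \<comment> \<open>The bounds \<open>D x\<close> only hold from a \<open>k\<close> depending on \<open>x\<close> on, so truncate to stay in a compact box.\<close>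
  define g where "g k x = min (h k x) (max 0 (D x))" for k x
  have g_eq: "\<forall>\<^sub>F k in sequentially. g k x = h k x" for x
    using D[of x] by eventually_elim (auto simp: g_def)
  have "g k \<in> {f. \<forall>x. f x \<in> {0..max 0 (D x)}}" for k
    using hpos[of k] by (auto simp: g_def less_imp_le)
  then obtain f where f: "\<And>S. closed S \<Longrightarrow> \<forall>\<^sub>F k in sequentially. g k \<in> S \<Longrightarrow> f \<in> S"
    by (rule compact_sequence_cluster[OF compact_box, of g]) blast+
  note cont = continuous_on_product_coordinates continuous_on_transition_op continuous_on_const
  have fa: "f a = 1"
  proof -
    have "closed {u :: 'a \<Rightarrow> real. u a = 1}"
      by (intro closed_Collect_eq cont)
    moreover have "\<forall>\<^sub>F k in sequentially. g k \<in> {u. u a = 1}"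
      using g_eq[of a] by eventually_elim (auto simp: ha)
    ultimately show ?thesis using f by blast
  qed
  have fy: "1 \<le> \<rho> * f y"
  proof -
    have "closed {u :: 'a \<Rightarrow> real. 1 \<le> \<rho> * u y}"
      by (intro closed_Collect_le continuous_on_mult cont)
    moreover have "\<forall>\<^sub>F k in sequentially. g k \<in> {u. 1 \<le> \<rho> * u y}"
      using g_eq[of y] by eventually_elim (auto simp: hy)
    ultimately show ?thesis using f by blast
  qed
  have fpos: "0 < f x" for x
  proof -
    \<comment> \<open>A lower bound uniform in \<open>k\<close> is needed, since strict positivity
      alone could be lost in the limit.\<close>
    obtain C where "C > 0" and C: "\<forall>\<^sub>F k in sequentially. C * h k a \<le> h k x"
      using harnack by blast
    have "closed {u :: 'a \<Rightarrow> real. C \<le> u x}"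
      by (intro closed_Collect_le cont)
    moreover have "\<forall>\<^sub>F k in sequentially. g k \<in> {u. C \<le> u x}"
      using g_eq[of x] C by eventually_elim (auto simp: ha)
    ultimately have "C \<le> f x" using f by blast
    with \<open>C > 0\<close> show ?thesis by simp
  qed
  have "transition_op K f x = f x" for x
  proof -
    obtain m where m: "x \<in> set_pmf (n_step K m a)" using sc by blast
    have tg: "\<forall>\<^sub>F k in sequentially. transition_op K (g k) x = transition_op K (h k) x"
    proof -
      have "\<forall>\<^sub>F k in sequentially. \<forall>z\<in>set_pmf (K x). g k z = h k z"
        unfolding eventually_ball_finite_distrib[OF fin] using g_eq by blast
      then show ?thesis by eventually_elim (auto simp: transition_op_def)
    qed
    have xk: "\<forall>\<^sub>F k in sequentially. x \<in> nat_ball K a k"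
      using m set_n_step_subset_nat_ball[of m _ K a] by (auto simp: eventually_sequentially)
    have Ph_nonneg: "0 \<le> transition_op K (h k) x" for k
      unfolding transition_op_def by (intro sum_nonneg mult_nonneg_nonneg less_imp_le[OF hpos]) simp
    \<comment> \<open>Since \<open>lam (N k) < 1\<close>, each \<open>h k\<close> is subharmonic at
      \<open>x\<close> once the balls contain \<open>x\<close>.\<close>
    have up: "f x \<le> transition_op K f x"
    proof -
      have "closed {u :: 'a \<Rightarrow> real. u x \<le> transition_op K u x}"
        by (intro closed_Collect_le cont)
      moreover have "\<forall>\<^sub>F k in sequentially. g k \<in> {u. u x \<le> transition_op K u x}"
        using g_eq[of x] tg xk
      proof eventually_elim
        case (elim k)
        then show ?case
          using Ph_nonneg[of k] hh[of x k] lam(1,2)[of "N k" "N k"]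
          by (auto intro!: mult_left_le_one_le)
      qed
      ultimately show ?thesis using f by blast
    qed
    \<comment> \<open>Freezing the discount at index \<open>j\<close> gives a closed condition that
      does not vary with \<open>k\<close>; only afterwards does \<open>j\<close> tend to
      infinity.\<close>
    have low: "(1 - 1 / (real j + 2)) * transition_op K f x \<le> f x" for j
    proof -
      have "closed {u :: 'a \<Rightarrow> real. (1 - 1 / (real j + 2)) * transition_op K u x \<le> u x}"
        by (intro closed_Collect_le continuous_on_mult cont)
      moreover have "\<forall>\<^sub>F k in sequentially.
          g k \<in> {u. (1 - 1 / (real j + 2)) * transition_op K u x \<le> u x}"
        using g_eq[of x] tg xk eventually_ge_at_top[of j]
      proof eventually_elim
        case (elim k)
        then show ?case
          using Ph_nonneg[of k] hh[of x k] lam(3)[of j "N k"] N[of k] by (auto intro!: mult_right_mono)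
      qed
      ultimately show ?thesis using f by blast
    qed
    have "(\<lambda>j. 1 - 1 / (real j + 2)) \<longlonglongrightarrow> 1"
      by real_asymp
    from tendsto_mult_right[OF this, of "transition_op K f x"]
    have "(\<lambda>j. (1 - 1 / (real j + 2)) * transition_op K f x) \<longlonglongrightarrow> transition_op K f x"
      by (simp only: mult_1_left)
    then have "transition_op K f x \<le> f x"
      using low by (intro LIMSEQ_le_const2) auto
    with up show ?thesis by simp
  qed
  then have "f constant_on UNIV" using fpos by (rule liouville)
  then have "f y = 1" using fa by (auto simp: constant_on_def)
  then show False using fy rho by simp
qed

section \<open>Exponential growth\<close>

text \<open>Induction along a path to \<open>y\<close>. While \<open>y\<close> is outside the
  \<open>k\<close>-ball of the current state, the discounted equation holds on that whole ball and
  \<open>edge\<close> costs one factor \<open>\<rho>\<close>. Once \<open>y\<close> is inside, where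
  the equation fails at \<open>y\<close> itself, \<open>near\<close> takes over.\<close>

lemma green_lower_bound:
  assumes fin: "\<And>x. finite (set_pmf (K x))" and l: "0 < l" "l < 1"
    and pos: "\<And>x y. 0 < green K l x y"
    and edge: "\<And>f x z. (\<forall>x. 0 < f x) \<Longrightarrow> (\<forall>w\<in>nat_ball K x k. f w = l * transition_op K f w) \<Longrightarrow>
                 z \<in> set_pmf (K x) \<Longrightarrow> \<rho> * f z \<le> f x"
    and near: "\<And>x y. y \<in> nat_ball K x k \<Longrightarrow> c \<le> green K l x y"
    and \<rho>: "0 < \<rho>" "\<rho> < 1" and c: "0 < c"
    and "y \<in> set_pmf (n_step K n x)"
  shows "c * \<rho> ^ n \<le> green K l x y"
  using assms(10)
proof (induction n arbitrary: x)
  case 0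
  then have "y \<in> nat_ball K x k" using set_n_step_subset_nat_ball[of 0 k K x] by auto
  then show ?case using near by simp
next
  case (Suc n)
  show ?case
  proof (cases "y \<in> nat_ball K x k")
    case True
    have "c * \<rho> ^ Suc n \<le> c * 1"
      using c \<rho> by (intro mult_left_mono power_le_one) auto
    then show ?thesis using near[OF True] by simp
  next
    case False
    obtain z where z: "z \<in> set_pmf (K x)" "y \<in> set_pmf (n_step K n z)"
      using Suc.prems unfolding n_step_Suc_first by auto
    have "green K l w y = l * transition_op K (\<lambda>z. green K l z y) w" if "w \<in> nat_ball K x k" for w
      using False that l green_step[of l K w y] fin by auto
    then have "\<rho> * green K l z y \<le> green K l x y"
      using pos z(1) by (intro edge[of "\<lambda>z. green K l z y"]) auto
    moreover have "c * \<rho> ^ Suc n \<le> \<rho> * green K l z y"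
      using Suc.IH[OF z(2)] \<rho> by (simp add: mult.left_commute)
    ultimately show ?thesis by simp
  qed
qed

text \<open>The constants are chosen in the order \<open>b\<close>, \<open>\<rho>\<close>,
  \<open>k\<close>, \<open>l\<close>, \<open>c\<close>, none depending on \<open>n\<close>. Summing
  the Green function over the \<open>n\<close>-ball then gives at least
  \<open>c * (b * \<rho>) ^ n\<close>, against a total mass of at most
  \<open>1 / (1 - l)\<close>.\<close>

lemma liouville_imp_no_exponential_growth:
  assumes fin: "\<And>x. finite (set_pmf (K x))"
    and sc: "\<And>x y. \<exists>n. y \<in> set_pmf (n_step K n x)"
    and homogeneous: "\<And>x y. \<exists>\<phi>. \<phi> x = y \<and> bij \<phi> \<and> (\<forall>z. K (\<phi> z) = map_pmf \<phi> (K z))"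
    and liouville: "\<And>f. (\<And>x. transition_op K f x = f x) \<Longrightarrow> (\<And>x. 0 < f x) \<Longrightarrow> f constant_on UNIV"
    and b: "1 < b" and growth: "\<forall>\<^sub>F n in sequentially. b ^ n \<le> real (card (nat_ball K a n))"
  shows False
proof -
  \<comment> \<open>The midpoint of \<open>1 / b\<close> and 1: below 1, as
    \<open>liouville_edge\<close> requires, yet with \<open>b * \<rho> > 1\<close>.\<close>
  define \<rho> where "\<rho> = (1 + 1 / b) / 2"
  have \<rho>: "0 < \<rho>" "\<rho> < 1" "1 < b * \<rho>"
    using b by (auto simp: \<rho>_def field_simps)
  \<comment> \<open>The state \<open>a\<close> has finitely many successors, so one \<open>k\<close>
    works for all of them.\<close>
  have "\<forall>\<^sub>F k in sequentially. \<forall>y\<in>set_pmf (K a). \<forall>f. (\<forall>x. 0 < f x) \<longrightarrow>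
      (\<forall>z\<in>nat_ball K a k. f z = (1 - 1 / (real k + 2)) * transition_op K f z) \<longrightarrow> \<rho> * f y \<le> f a"
    unfolding eventually_ball_finite_distrib[OF fin]
    using liouville_edge[OF fin sc liouville \<rho>(2)] by blast
  then obtain k where k: "\<forall>y\<in>set_pmf (K a). \<forall>f. (\<forall>x. 0 < f x) \<longrightarrow>
      (\<forall>z\<in>nat_ball K a k. f z = (1 - 1 / (real k + 2)) * transition_op K f z) \<longrightarrow> \<rho> * f y \<le> f a"
    by (auto simp: eventually_sequentially)
  define l where "l = 1 - 1 / (real k + 2)"
  have l: "0 < l" "l < 1" by (auto simp: l_def field_simps)
  have pos: "0 < green K l x y" for x y
    using sc[of y x] l by (auto intro: green_pos)
  \<comment> \<open>An automorphism taking \<open>a\<close> to \<open>x\<close> pulls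
    \<open>f\<close> back to \<open>f \<circ> \<phi>\<close> near \<open>a\<close>, so the
    \<open>k\<close> found at \<open>a\<close> is valid at every state.\<close>
  have edge: "\<rho> * f z \<le> f x"
    if f: "\<forall>x. 0 < f x" "\<forall>w\<in>nat_ball K x k. f w = l * transition_op K f w" and z: "z \<in> set_pmf (K x)"
    for f x z
  proof -
    obtain \<phi> where \<phi>: "\<phi> a = x" "bij \<phi>" and eq: "\<And>z. K (\<phi> z) = map_pmf \<phi> (K z)"
      using homogeneous by metis
    obtain y where y: "y \<in> set_pmf (K a)" "z = \<phi> y" using z eq[of a] \<phi> by auto
    have "\<forall>w\<in>nat_ball K a k. (f \<circ> \<phi>) w = l * transition_op K (f \<circ> \<phi>) w"
    proof
      fix w assume "w \<in> nat_ball K a k"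
      then have "\<phi> w \<in> nat_ball K x k" using nat_ball_map[of K \<phi> a k] eq \<phi> by auto
      then show "(f \<circ> \<phi>) w = l * transition_op K (f \<circ> \<phi>) w"
        using f(2) transition_op_map[of K \<phi> f w] eq \<phi> by (auto simp: bij_is_inj)
    qed
    then have "\<rho> * (f \<circ> \<phi>) y \<le> (f \<circ> \<phi>) a"
      using k[rule_format, OF y(1), of "f \<circ> \<phi>"] f(1) unfolding l_def by simp
    then show ?thesis using \<phi> y by simp
  qed
  \<comment> \<open>The minimum over one finite ball suffices, because \<open>green\<close> is
    invariant under the automorphisms. Inserting 1 makes the set visibly nonempty for
    \<open>Min\<close>.\<close>
  define c where "c = Min (insert 1 (green K l a ` nat_ball K a k))"
  have finball: "finite (nat_ball K x n)" for x n by (rule finite_nat_ball[OF fin])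
  have c: "0 < c" using finball pos by (auto simp: c_def)
  have near: "c \<le> green K l x y" if y: "y \<in> nat_ball K x k" for x y
  proof -
    obtain \<phi> where \<phi>: "\<phi> a = x" "bij \<phi>" and eq: "\<And>z. K (\<phi> z) = map_pmf \<phi> (K z)"
      using homogeneous by metis
    obtain z where z: "z \<in> nat_ball K a k" "y = \<phi> z" using y nat_ball_map[of K \<phi> a k] eq \<phi> by auto
    have "green K l x y = green K l a z"
      using green_map[of K \<phi> l a z] eq \<phi> z by (auto simp: bij_is_inj)
    then show ?thesis using z finball by (auto simp: c_def intro!: Min_le)
  qed
  have "\<forall>\<^sub>F n in sequentially. c * (b * \<rho>) ^ n \<le> 1 / (1 - l)"
    using growth
  proof eventually_elim
    case (elim n)
    have "c * (b * \<rho>) ^ n = b ^ n * (c * \<rho> ^ n)" by (simp add: power_mult_distrib)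
    also have "\<dots> \<le> real (card (nat_ball K a n)) * (c * \<rho> ^ n)"
      using elim c \<rho> by (intro mult_right_mono) auto
    also have "\<dots> \<le> (\<Sum>y\<in>nat_ball K a n. green K l a y)"
    proof (rule sum_bounded_below)
      fix y assume "y \<in> nat_ball K a n"
      then obtain s where s: "s \<le> n" "y \<in> set_pmf (n_step K s a)" by (auto simp: nat_ball_def)
      \<comment> \<open>A point of the ball may be reached in \<open>s < n\<close> steps; as
        \<open>\<rho> < 1\<close>, the bound with exponent \<open>n\<close> is the weaker
        one.\<close>
      have "c * \<rho> ^ n \<le> c * \<rho> ^ s"
        using c \<rho> s by (intro mult_left_mono power_decreasing) auto
      also have "\<dots> \<le> green K l a y"
        by (rule green_lower_bound[OF fin l pos edge near \<rho>(1,2) c s(2)])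
      finally show "c * \<rho> ^ n \<le> green K l a y" .
    qed
    also have "\<dots> \<le> 1 / (1 - l)" using l finball by (intro sum_green_le) auto
    finally show ?case .
  qed
  moreover have "filterlim (\<lambda>n. c * (b * \<rho>) ^ n) at_top sequentially"
    using c \<rho>(3) by real_asymp
  then have "\<forall>\<^sub>F n in sequentially. 1 / (1 - l) < c * (b * \<rho>) ^ n"
    by (simp add: filterlim_at_top_dense)
  ultimately have "\<forall>\<^sub>F n in sequentially. False"
    by eventually_elim auto
  then show False by simp
qed

theorem mainTheorem1:
  fixes K :: "'a \<Rightarrow> 'a pmf" and \<Gamma> :: "('a \<Rightarrow> 'a) set"
  assumes "strongly_connected K"
    and "finitely_supported K"
    and "subgroup \<Gamma> (BijGroup UNIV)"
    and "acts_transitively \<Gamma>"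
    and "invariant_under K \<Gamma>"
    and "exponential_ball_growth K"
  shows "\<exists>f :: 'a \<Rightarrow> real. harmonic K f \<and> (\<forall>x. f x > 0) \<and> \<not> f constant_on UNIV"
proof (rule ccontr)
  assume none: "\<not> ?thesis"
  have fin: "finite (set_pmf (K x))" for x
    using assms(2) by (simp add: finitely_supported_def pmf_positive_iff)
  have sc: "\<exists>n. y \<in> set_pmf (n_step K n x)" for x y
    using assms(1) by (simp add: strongly_connected_def pmf_positive_iff)
  have homogeneous: "\<exists>\<phi>. \<phi> x = y \<and> bij \<phi> \<and> (\<forall>z. K (\<phi> z) = map_pmf \<phi> (K z))" for x y
  proof -
    obtain \<phi> where \<phi>: "\<phi> \<in> \<Gamma>" "\<phi> x = y" using assms(4) by (auto simp: acts_transitively_def)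
    have "\<phi> \<in> carrier (BijGroup UNIV)" using assms(3) \<phi>(1) by (rule subgroup.mem_carrier)
    then have "bij \<phi>" by (simp add: BijGroup_def Bij_def)
    moreover have "pmf (K (\<phi> u)) (\<phi> v) = pmf (K u) v" for u v
      using assms(5) \<phi>(1) by (simp add: invariant_under_def)
    ultimately show ?thesis using \<phi>(2) invariant_kernel_map by metis
  qed
  have liouville: "f constant_on UNIV"
    if "\<And>x. transition_op K f x = f x" "\<And>x. 0 < f x" for f
    using none that harmonic_iff_transition_op[of K f, OF fin] by blast
  fix a :: 'a
  obtain b where b: "1 < b"
    and growth: "\<And>g. \<forall>\<^sub>F r in at_top. b powr r \<le> real (card (directed_ball K g r))"
    using assms(6) by (auto simp: exponential_ball_growth_def)
  \<comment> \<open>Restricting the real radius to integers turns directed balls into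
    \<open>nat_ball\<close> and \<open>powr\<close> into an ordinary power.\<close>
  have "\<forall>\<^sub>F n in sequentially. b powr real n \<le> real (card (directed_ball K a (real n)))"
    using eventually_compose_filterlim[OF growth filterlim_real_sequentially] .
  then have "\<forall>\<^sub>F n in sequentially. b ^ n \<le> real (card (nat_ball K a n))"
    using b by (simp add: directed_ball_of_nat powr_realpow)
  from liouville_imp_no_exponential_growth[OF fin sc homogeneous liouville b this]
  show False .
qed

end
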